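(* Let $d,n\in\mathbb{N}$. Let $x_1,\dots,x_m\in\mathbb{T}^d$ be finitely many points and $w_1,\dots,w_m>0$ be positive weights such that the quadrature rule $Q[f]=\sum_{j=1}^m w_j f(x_j)$ is exact for all $f\in\Pi_{2n}^d$, i.e. $$\sum_{j=1}^m w_j f(x_j)=\int_{\mathbb{T}^d} f(x)\,\mathrm{d}x\qquad\text{for all } f\in\Pi_{2n}^d.$$ Then the covering radius of the quadrature points satisfies $$\delta=\max_{x\in\mathbb{T}^d}\min_{j}|x_j-x|_\infty\le\frac{2^{d-1}}{2n+1}.$$
   Context: $\mathbb{N}=\{1,2,\dots\}$. $\mathbb{T}^d\simeq[0,1)^d$ is the $d$-dimensional torus (unit cube with opposing sides identified, i.e. $\mathbb{R}^d/\mathbb{Z}^d$) with normalized Lebesgue measure $\mathrm{d}x$. For $N\in\mathbb{N}$, $\Pi_N^d$ denotes the space of trigonometric polynomials $f:\mathbb{T}^d\to\mathbb{C}$ of the form $f(x)=\sum_{k\in\mathbb{Z}^d,\ \|k\|_\infty\le N}c_k\,\mathrm{e}^{2\pi i k\cdot x}$ with $c_k\in\mathbb{C}$. The wrap-around infinity distance is $|x-y|_\infty=\inf_{z\in\mathbb{Z}^d}\|x-y+z\|_\infty$. *)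

theory Defs
  imports "HOL-Analysis.Analysis"
begin

text \<open>
  The dimension \<open>d \<ge> 1\<close> is the cardinality of the finite index type \<open>'d\<close>. A point of the torus
  is given by its representative in the half-open unit cube, and a function on the torus by its
  periodic extension to \<open>\<real>\<^sup>d\<close>; normalized Lebesgue measure is then \<^const>\<open>lborel\<close> on the cube.
  The maximum norm is the library's \<^const>\<open>infnorm\<close>.
\<close>

definition torus :: "(real ^ 'd) set" where
  "torus = {x. \<forall>i. x $ i \<in> {0..<1}}"

definition int_lattice :: "(real ^ 'd) set" where
  "int_lattice = {z. \<forall>i. z $ i \<in> \<int>}"

definition trig_polys :: "nat \<Rightarrow> (real ^ 'd \<Rightarrow> complex) set" where
  "trig_polys N = {f. \<exists>c. \<forall>x. f x =
     (\<Sum>k \<in> {k \<in> int_lattice. infnorm k \<le> real N}.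
        c k * exp (2 * of_real pi * \<i> * of_real (k \<bullet> x)))}"

definition wrap_dist :: "real ^ 'd \<Rightarrow> real ^ 'd \<Rightarrow> real" where
  "wrap_dist x y = (INF z \<in> int_lattice. infnorm (x - y + z))"

definition exact_quadrature :: "nat \<Rightarrow> (nat \<Rightarrow> real ^ 'd) \<Rightarrow> (nat \<Rightarrow> real) \<Rightarrow> nat \<Rightarrow> bool" where
  "exact_quadrature m x w N \<longleftrightarrow>
     (\<forall>f \<in> trig_polys N. (\<Sum>j = 1..m. of_real (w j) * f (x j)) = (LINT y:torus|lborel. f y))"

definition min_dist :: "nat \<Rightarrow> (nat \<Rightarrow> real ^ 'd) \<Rightarrow> real ^ 'd \<Rightarrow> real" where
  "min_dist m x y = (MIN j \<in> {1..m}. wrap_dist (x j) y)"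

text \<open>
  The operator \<^const>\<open>Max\<close> only applies to finite sets, so the maximum over the torus is expressed
  by \<^const>\<open>Greatest\<close>; it exists for every nonempty family of points by the lemma
  \<open>covering_radius_is_max\<close> below.
\<close>

definition covering_radius :: "nat \<Rightarrow> (nat \<Rightarrow> real ^ 'd) \<Rightarrow> real" where
  "covering_radius m x = (GREATEST r. r \<in> min_dist m x ` torus)"

lemma finite_frequencies: "finite {k \<in> (int_lattice :: (real ^ 'd) set). infnorm k \<le> real N}"
proof -
  let ?S = "(\<lambda>i::int. real_of_int i) ` {- int N..int N}"
  have "{k \<in> (int_lattice :: (real ^ 'd) set). infnorm k \<le> real N} \<subseteq> {k. \<forall>i. k $ i \<in> ?S}"
  proof safe
    fix k :: "real ^ 'd" and i
    assume k: "k \<in> int_lattice" and n: "infnorm k \<le> real N"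
    obtain a :: int where a: "k $ i = of_int a"
      using k by (auto simp: int_lattice_def elim: Ints_cases)
    have "\<bar>k $ i\<bar> \<le> real N"
      using component_le_infnorm_cart[of k i] n by linarith
    then have "a \<in> {- int N..int N}" using a by auto
    then show "k $ i \<in> ?S" using a by blast
  qed
  moreover have "{k :: real ^ 'd. \<forall>i. k $ i \<in> ?S} \<subseteq> vec_lambda ` (\<Pi>\<^sub>E i\<in>UNIV. ?S)"
    by (auto intro!: image_eqI[of _ _ "vec_nth _"])
  moreover have "finite (vec_lambda ` (\<Pi>\<^sub>E i\<in>UNIV. ?S) :: (real ^ 'd) set)"
    by (intro finite_imageI finite_PiE) auto
  ultimately show ?thesis by (meson finite_subset)
qed

lemma int_lattice_0 [simp]: "0 \<in> int_lattice"
  by (simp add: int_lattice_def)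

lemma wrap_dist_bdd: "bdd_below ((\<lambda>z. infnorm (x - y + z)) ` int_lattice)"
  by (rule bdd_belowI[of _ 0]) (auto simp: infnorm_pos_le)

lemma wrap_dist_le: "wrap_dist x y \<le> wrap_dist x y' + infnorm (y - y')"
proof -
  have "wrap_dist x y - infnorm (y - y') \<le> infnorm (x - y' + z)" if "z \<in> int_lattice" for z
  proof -
    have "wrap_dist x y \<le> infnorm (x - y + z)"
      unfolding wrap_dist_def by (rule cINF_lower[OF wrap_dist_bdd that])
    also have "x - y + z = (x - y' + z) + (y' - y)" by simp
    also have "infnorm \<dots> \<le> infnorm (x - y' + z) + infnorm (y' - y)" by (rule infnorm_triangle)
    finally show ?thesis by (simp add: infnorm_sub)
  qed
  then have "wrap_dist x y - infnorm (y - y') \<le> wrap_dist x y'"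
    unfolding wrap_dist_def[of x y'] by (intro cINF_greatest) (use int_lattice_0 in blast)+
  then show ?thesis by simp
qed

lemma wrap_dist_shift:
  fixes v :: "real ^ 'd"
  assumes "v \<in> int_lattice"
  shows "wrap_dist x (y + v) = wrap_dist x y"
proof -
  have "(int_lattice :: (real ^ 'd) set) = (\<lambda>z. z - v) ` int_lattice"
  proof (intro equalityI subsetI)
    fix z :: "real ^ 'd" assume "z \<in> int_lattice"
    then have "z + v \<in> int_lattice" using assms by (auto simp: int_lattice_def)
    then show "z \<in> (\<lambda>z. z - v) ` int_lattice" by (metis add_diff_cancel_right' image_eqI)
  qed (use assms in \<open>auto simp: int_lattice_def\<close>)
  then have "wrap_dist x y = (INF z \<in> (\<lambda>z. z - v) ` int_lattice. infnorm (x - y + z))"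
    unfolding wrap_dist_def by simp
  also have "\<dots> = wrap_dist x (y + v)"
    unfolding wrap_dist_def by (simp add: image_image algebra_simps)
  finally show ?thesis ..
qed

lemma continuous_on_wrap_dist: "continuous_on S (wrap_dist x)"
proof (rule continuous_onI)
  fix y and e :: real assume "e > 0"
  have "dist (wrap_dist x y') (wrap_dist x y) \<le> e" if "dist y' y < e" for y'
  proof -
    have "infnorm (y' - y) < e"
      using that infnorm_le_norm[of "y' - y"] by (simp add: dist_norm)
    then show ?thesis
      using wrap_dist_le[of x y' y] wrap_dist_le[of x y y']
      by (simp add: dist_real_def infnorm_sub abs_le_iff)
  qed
  then show "\<exists>d>0. \<forall>y'\<in>S. dist y' y < d \<longrightarrow> dist (wrap_dist x y') (wrap_dist x y) \<le> e"
    using \<open>e > 0\<close> by blast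
qed

lemma continuous_on_min_dist:
  assumes "m \<ge> 1"
  shows "continuous_on S (min_dist m x)"
  using assms
proof (induction m rule: dec_induct)
  case base
  show ?case using continuous_on_wrap_dist[of S "x 1"] by (simp add: min_dist_def[abs_def])
next
  case (step m)
  have "min_dist (Suc m) x = (\<lambda>y. min (wrap_dist (x (Suc m)) y) (min_dist m x y))"
    using step.hyps by (auto simp: min_dist_def fun_eq_iff atLeastAtMostSuc_conv)
  then show ?case
    using continuous_on_min[OF continuous_on_wrap_dist step.IH] by simp
qed

lemma covering_radius_is_max:
  assumes "m \<ge> 1"
  shows "covering_radius m x \<in> min_dist m x ` torus"
    and "y \<in> torus \<Longrightarrow> min_dist m x y \<le> covering_radius m x"
proof -
  define C :: "(real ^ 'a) set" where "C = cbox 0 1"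
  have "compact C" "C \<noteq> {}" unfolding C_def
    by (auto simp: compact_cbox interval_ne_empty_cart)
  then obtain p where p: "p \<in> C" "\<And>y. y \<in> C \<Longrightarrow> min_dist m x y \<le> min_dist m x p"
    using continuous_attains_sup[OF _ _ continuous_on_min_dist[OF assms]] by metis
  define q where "q = (\<chi> i. frac (p $ i))"
  have q: "q \<in> torus" by (auto simp: q_def torus_def frac_lt_1)
  have v: "p - q \<in> int_lattice" by (auto simp: q_def int_lattice_def frac_def)
  have "wrap_dist a p = wrap_dist a q" for a
    using wrap_dist_shift[OF v, of a q] by simp
  then have pq: "min_dist m x p = min_dist m x q" by (simp add: min_dist_def)
  have "torus \<subseteq> C" by (auto simp: torus_def C_def mem_box_cart less_imp_le)
  then have q_max: "min_dist m x y \<le> min_dist m x q" if "y \<in> torus" for y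
    using p(2) pq that by auto
  then have "covering_radius m x = min_dist m x q"
    unfolding covering_radius_def using q by (intro Greatest_equality) auto
  then show "covering_radius m x \<in> min_dist m x ` torus"
    and "y \<in> torus \<Longrightarrow> min_dist m x y \<le> covering_radius m x"
    using q q_max by auto
qed

end

theory Submission
  imports Defs
begin

text \<open>
  Write \<open>M = 2 n + 1\<close>, \<open>r = 2\<^bsup>d - 1\<^esup> / M\<close>, and let \<open>p\<close> be the univariate trigonometric polynomial with
  coefficients \<open>sin (\<pi> k / M)\<close> for \<open>k = 1, \<dots>, 2 n\<close>. If no node lies within \<open>r\<close> of \<open>y\<close>, test the
  quadrature rule on
  \<open>f x = ((\<Sum>i. cos (2 \<pi> (x\<^sub>i - y\<^sub>i))) - (d - 1) - cos (2 \<pi> r)) \<Prod>i. \<bar>p (x\<^sub>i - y\<^sub>i)\<bar>\<^sup>2\<close>,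
  which lies in \<open>\<Pi>\<^bsub>2 n\<^esub>\<close>. As \<open>r < 1 / 2\<close> (the wrap-around distance never exceeds \<open>1 / 2\<close>), it is
  nonpositive at every node, since there some cosine is below \<open>cos (2 \<pi> r)\<close> and the others are at most 1. Its
  integral is a positive multiple of \<open>d cos (\<pi> / M) - (d - 1) - cos (2 \<pi> r)\<close>, which is positive
  because \<open>1 - cos (\<pi> / M) \<le> \<pi>\<^sup>2 / (2 M\<^sup>2)\<close> and \<open>1 - cos (2 \<pi> r) \<ge> 8 r\<^sup>2\<close>: a contradiction.
\<close>

section \<open>Integrals of products of univariate functions over the torus\<close>

text \<open>Fubini for separated variables: \<open>lborel\<close> on \<open>real ^ 'd\<close> is the
  image of the product measure indexed by \<open>Basis\<close>, and the \<open>Basis\<close> vectors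
  \<open>axis i 1\<close> are in bijection with the indices \<open>i\<close>, so the product rule
  for product measures carries over.\<close>

lemma has_bochner_integral_lborel_prod_vec:
  fixes g :: "'d::finite \<Rightarrow> real \<Rightarrow> 'a::{real_normed_field,banach,second_countable_topology}"
  assumes int: "\<And>i. integrable lborel (g i)"
  shows "has_bochner_integral lborel (\<lambda>x::real ^ 'd. \<Prod>i\<in>UNIV. g i (x $ i))
           (\<Prod>i\<in>UNIV. integral\<^sup>L lborel (g i))"
proof -
  interpret product_sigma_finite "\<lambda>_::real ^ 'd. lborel :: real measure" ..
  let ?P = "\<Pi>\<^sub>M b\<in>(Basis :: (real ^ 'd) set). (lborel :: real measure)"
  define e :: "'d \<Rightarrow> real ^ 'd" where "e i = axis i 1" for i
  have inj: "inj e" by (auto simp: inj_on_def e_def axis_eq_axis)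
  have Basis: "(Basis :: (real ^ 'd) set) = range e" by (auto simp: Basis_vec_def e_def)
  have reindex: "(\<Prod>b\<in>Basis. F b) = (\<Prod>i\<in>UNIV. F (e i))" for F :: "real ^ 'd \<Rightarrow> 'a"
    unfolding Basis by (simp add: prod.reindex[OF inj])
  have int': "integrable lborel (g (inv e b))" for b by (rule int)
  have g [measurable]: "g i \<in> borel_measurable borel" for i
    using borel_measurable_integrable[OF int[of i]] by simp
  have "integrable ?P (\<lambda>f. \<Prod>b\<in>Basis. g (inv e b) (f b))"
    by (rule product_integrable_prod) (auto intro: int')
  moreover have "(LINT f|?P. (\<Prod>b\<in>Basis. g (inv e b) (f b))) =
      (\<Prod>b\<in>Basis. integral\<^sup>L lborel (g (inv e b)))"
    by (rule product_integral_prod) (auto intro: int')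
  ultimately have "has_bochner_integral ?P (\<lambda>f. \<Prod>b\<in>Basis. g (inv e b) (f b))
      (\<Prod>b\<in>Basis. integral\<^sup>L lborel (g (inv e b)))"
    by (simp add: has_bochner_integral_iff)
  then have *: "has_bochner_integral ?P (\<lambda>f. \<Prod>i\<in>UNIV. g i (f (e i)))
      (\<Prod>i\<in>UNIV. integral\<^sup>L lborel (g i))"
    by (simp add: reindex inj)
  have comp: "(\<Sum>b\<in>Basis. f b *\<^sub>R b) $ i = f (e i)" for f :: "real ^ 'd \<Rightarrow> real" and i
  proof -
    have "(\<Sum>b\<in>Basis. f b *\<^sub>R b) $ i = (\<Sum>b\<in>Basis. f b *\<^sub>R b) \<bullet> e i"
      by (simp add: e_def inner_axis)
    also have "\<dots> = f (e i)" by (rule inner_sum_left_Basis) (simp add: Basis)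
    finally show ?thesis .
  qed
  show ?thesis
    unfolding lborel_eq[where 'a = "real ^ 'd"]
    by (subst has_bochner_integral_distr) (use * in \<open>simp_all add: comp del: sum_component\<close>)
qed

text \<open>The torus is a product of half-open intervals, so its indicator can be absorbed factor
  by factor into the univariate functions.\<close>

lemma has_bochner_integral_torus_prod:
  fixes h :: "'d::finite \<Rightarrow> real \<Rightarrow> complex"
  assumes "\<And>i. set_integrable lborel {0..<1} (h i)"
  shows "has_bochner_integral lborel (\<lambda>x. indicator torus x *\<^sub>R (\<Prod>i\<in>UNIV. h i (x $ i)))
           (\<Prod>i\<in>UNIV. LINT t:{0..<1}|lborel. h i t)"
proof -
  have "(\<Prod>i\<in>UNIV. indicator {0..<1} (x $ i) *\<^sub>R h i (x $ i)) =
      indicator torus x *\<^sub>R (\<Prod>i\<in>UNIV. h i (x $ i))" for x :: "real ^ 'd"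
  proof (cases "x \<in> torus")
    case False
    then obtain i where "x $ i \<notin> {0..<1}" by (auto simp: torus_def)
    then have "(\<Prod>i\<in>UNIV. indicator {0..<1} (x $ i) *\<^sub>R h i (x $ i)) = 0"
      by (intro prod_zero bexI[of _ i]) simp_all
    with False show ?thesis by simp
  qed (auto simp: torus_def)
  then show ?thesis
    using has_bochner_integral_lborel_prod_vec[of "\<lambda>i t. indicator {0..<1} t *\<^sub>R h i t"] assms
    by (simp add: set_integrable_def set_lebesgue_integral_def)
qed

section \<open>Univariate characters and their orthogonality\<close>

definition expi :: "int \<Rightarrow> real \<Rightarrow> complex" where
  "expi k t = exp (2 * of_real pi * \<i> * of_real (of_int k * t))"

lemma expi_0 [simp]: "expi 0 t = 1"
  by (simp add: expi_def)

lemma expi_add: "expi (k + l) t = expi k t * expi l t"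
  by (simp add: expi_def algebra_simps flip: exp_add)

lemma expi_diff: "expi k (t - s) = expi k (- s) * expi k t"
  by (simp add: expi_def algebra_simps flip: exp_add)

lemma expi_eq_cis: "expi k t = cis (2 * pi * of_int k * t)"
  by (simp add: expi_def cis_conv_exp mult_ac)

text \<open>For \<open>k\<close> nonzero the antiderivative \<open>exp (c * (t - s)) / c\<close> is
  1-periodic, so its increment over a period vanishes. The shift \<open>s\<close> is carried along
  because the test function is later centred at an arbitrary point \<open>y\<close>.\<close>

lemma has_bochner_integral_expi:
  "has_bochner_integral lborel (\<lambda>t. indicator {0..<1} t *\<^sub>R expi k (t - s)) (if k = 0 then 1 else 0)"
proof -
  define c where "c = 2 * of_real pi * \<i> * of_int k"
  have c: "expi k (t - s) = exp (c * (of_real t - of_real s))" for t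
    by (simp add: expi_def c_def algebra_simps)
  define F where "F t = (if k = 0 then of_real t
    else exp (c * (of_real t - of_real s)) / c)" for t :: real
  have "has_bochner_integral lborel (\<lambda>t. indicator {0..1} t *\<^sub>R expi k (t - s)) (F 1 - F 0)"
  proof (rule has_bochner_integral_FTC_Icc)
    show "continuous_on {0..1} (\<lambda>t. expi k (t - s))"
      unfolding expi_def by (intro continuous_intros)
    show "(F has_vector_derivative expi k (t - s)) (at t within {0..1})" for t
    proof (cases "k = 0")
      case True
      have "((\<lambda>z. z) has_field_derivative 1) (at (of_real t :: complex))" by simp
      from has_vector_derivative_real_field[OF this] show ?thesis
        using True by (simp add: F_def[abs_def])
    next
      case False
      then have "((\<lambda>z. exp (c * (z - of_real s)) / c) has_field_derivative
          exp (c * (of_real t - of_real s))) (at (of_real t))"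
        by (auto intro!: derivative_eq_intros simp: c_def)
      from has_vector_derivative_real_field[OF this] show ?thesis
        using False by (simp add: F_def[abs_def] c)
    qed
  qed simp
  moreover have "F 1 - F 0 = (if k = 0 then 1 else 0)"
  proof -
    have "expi k (1 - s) = expi k (- s)"
      by (simp add: expi_diff[of k 1 s]) (simp add: expi_eq_cis complex_eq_iff)
    then show ?thesis by (auto simp: F_def c[of 1, simplified] c[of 0, simplified] simp flip: diff_divide_distrib)
  qed
  ultimately have "has_bochner_integral lborel (\<lambda>t. indicator {0..1} t *\<^sub>R expi k (t - s))
      (if k = 0 then 1 else 0)" by simp
  \<comment> \<open>The fundamental theorem of calculus was applied on the closed interval; the
    torus uses the half-open one, which differs only by the null set \<open>{1}\<close>.\<close>
  moreover have "AE t in lborel. indicator {0..1} t *\<^sub>R expi k (t - s) =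
      indicator {0..<1} t *\<^sub>R expi k (t - s)"
    using AE_lborel_singleton[of 1] by eventually_elim (auto split: split_indicator)
  moreover have "(\<lambda>t. expi k (t - s)) \<in> borel_measurable borel"
    unfolding expi_def by (intro borel_measurable_continuous_onI continuous_intros)
  ultimately show ?thesis
    by (subst has_bochner_integral_cong_AE[symmetric]) (auto intro!: borel_measurable_indicator)
qed

section \<open>Trigonometric polynomials in one and several variables\<close>

lemma trig_polys_add:
  fixes f g :: "real ^ 'd \<Rightarrow> complex"
  assumes "f \<in> trig_polys N" "g \<in> trig_polys N"
  shows "(\<lambda>x. f x + g x) \<in> trig_polys N"
proof -
  let ?K = "{k \<in> int_lattice. infnorm k \<le> real N} :: (real ^ 'd) set"
  obtain b c where "\<And>x. f x = (\<Sum>k\<in>?K. b k * exp (2 * of_real pi * \<i> * of_real (k \<bullet> x)))"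
    and "\<And>x. g x = (\<Sum>k\<in>?K. c k * exp (2 * of_real pi * \<i> * of_real (k \<bullet> x)))"
    using assms by (auto simp: trig_polys_def)
  then have "f x + g x = (\<Sum>k\<in>?K. (b k + c k) * exp (2 * of_real pi * \<i> * of_real (k \<bullet> x)))" for x
    by (simp add: distrib_right sum.distrib)
  then show ?thesis by (auto simp: trig_polys_def intro: exI[of _ "\<lambda>k. b k + c k"])
qed

lemma trig_polys_sum:
  fixes f :: "'i \<Rightarrow> real ^ 'd \<Rightarrow> complex"
  assumes "finite I" "\<And>i. i \<in> I \<Longrightarrow> f i \<in> trig_polys N"
  shows "(\<lambda>x. \<Sum>i\<in>I. f i x) \<in> trig_polys N"
  using assms
proof (induction I rule: finite_induct)
  case empty
  show ?case by (auto simp: trig_polys_def intro: exI[of _ "\<lambda>k. 0"])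
qed (simp add: trig_polys_add)

lemma trig_polys_cmult:
  fixes f :: "real ^ 'd \<Rightarrow> complex"
  assumes "f \<in> trig_polys N"
  shows "(\<lambda>x. a * f x) \<in> trig_polys N"
proof -
  let ?K = "{k \<in> int_lattice. infnorm k \<le> real N} :: (real ^ 'd) set"
  obtain c where c: "\<And>x. f x = (\<Sum>k\<in>?K. c k * exp (2 * of_real pi * \<i> * of_real (k \<bullet> x)))"
    using assms by (auto simp: trig_polys_def)
  have "a * f x = (\<Sum>k\<in>?K. (a * c k) * exp (2 * of_real pi * \<i> * of_real (k \<bullet> x)))" for x
    by (simp add: c sum_distrib_left mult_ac)
  then show ?thesis by (auto simp: trig_polys_def intro: exI[of _ "\<lambda>k. a * c k"])
qed

lemma trig_polys_expi_prod:
  fixes k :: "'d::finite \<Rightarrow> int"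
  assumes "\<And>i. \<bar>k i\<bar> \<le> int N"
  shows "(\<lambda>x :: real ^ 'd. \<Prod>i\<in>UNIV. expi (k i) (x $ i)) \<in> trig_polys N"
proof -
  define v :: "real ^ 'd" where "v = (\<chi> i. of_int (k i))"
  let ?K = "{k \<in> int_lattice. infnorm k \<le> real N} :: (real ^ 'd) set"
  have "infnorm v \<le> real N"
    unfolding infnorm_cart
  proof (rule cSup_least)
    have "\<bar>real_of_int (k i)\<bar> \<le> real N" for i using assms[of i] by linarith
    then show "a \<le> real N" if "a \<in> {\<bar>v $ i\<bar> |i. i \<in> UNIV}" for a
      using that by (auto simp: v_def)
  qed auto
  then have v: "v \<in> ?K" by (simp add: v_def int_lattice_def)
  have "(\<Prod>i\<in>UNIV. expi (k i) (x $ i)) = exp (2 * of_real pi * \<i> * of_real (v \<bullet> x))" for x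
    by (simp add: expi_def v_def inner_vec_def sum_distrib_left mult_ac flip: exp_sum)
  also have "exp (2 * of_real pi * \<i> * of_real (v \<bullet> x)) =
      (\<Sum>k\<in>?K. (if k = v then 1 else 0) * exp (2 * of_real pi * \<i> * of_real (k \<bullet> x)))" for x
    using v sum.delta[OF finite_frequencies, of v "\<lambda>k. exp (2 * of_real pi * \<i> * of_real (k \<bullet> x))" N]
    by (simp add: if_distrib[of "\<lambda>a. a * _"] cong: if_cong)
  finally show ?thesis
    by (auto simp: trig_polys_def intro: exI[of _ "\<lambda>k. if k = v then 1 else 0"])
qed

text \<open>A univariate version with integer frequencies, from which members of
  \<open>trig_polys\<close> are built as products: the maximum norm bounds each coordinate of the
  frequency separately.\<close>

definition trig_polys1 :: "nat \<Rightarrow> (real \<Rightarrow> complex) set" where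
  "trig_polys1 N = {h. \<exists>c. \<forall>t. h t = (\<Sum>k = - int N..int N. c k * expi k t)}"

lemma trig_polys1_add:
  assumes "f \<in> trig_polys1 N" "g \<in> trig_polys1 N"
  shows "(\<lambda>t. f t + g t) \<in> trig_polys1 N"
proof -
  obtain b c where "\<And>t. f t = (\<Sum>k = - int N..int N. b k * expi k t)"
    and "\<And>t. g t = (\<Sum>k = - int N..int N. c k * expi k t)"
    using assms by (auto simp: trig_polys1_def)
  then have "f t + g t = (\<Sum>k = - int N..int N. (b k + c k) * expi k t)" for t
    by (simp add: distrib_right sum.distrib)
  then show ?thesis by (auto simp: trig_polys1_def intro: exI[of _ "\<lambda>k. b k + c k"])
qed

lemma trig_polys1_sum:
  assumes "finite I" "\<And>i. i \<in> I \<Longrightarrow> f i \<in> trig_polys1 N"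
  shows "(\<lambda>t. \<Sum>i\<in>I. f i t) \<in> trig_polys1 N"
  using assms
proof (induction I rule: finite_induct)
  case empty
  show ?case by (auto simp: trig_polys1_def intro: exI[of _ "\<lambda>k. 0"])
qed (simp add: trig_polys1_add)

text \<open>A translation only multiplies the coefficient by the constant
  \<open>expi k (- s)\<close>.\<close>

lemma trig_polys1_expi:
  assumes "\<bar>k\<bar> \<le> int N"
  shows "(\<lambda>t. a * expi k (t - s)) \<in> trig_polys1 N"
proof -
  have "a * expi k (t - s) = (\<Sum>l = - int N..int N. (if l = k then a * expi k (- s) else 0) * expi l t)" for t
    using assms by (simp add: expi_diff[of k t s] if_distrib[of "\<lambda>a. a * _"] abs_le_iff cong: if_cong)
  then show ?thesis
    by (auto simp: trig_polys1_def intro: exI[of _ "\<lambda>l. if l = k then a * expi k (- s) else 0"])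
qed

text \<open>Multiplying out the product of sums yields one term per choice \<open>g\<close> of a
  frequency in each coordinate, and such choices are exactly the lattice points of maximum norm at
  most \<open>N\<close>.\<close>

lemma trig_polys_prod:
  fixes h :: "'d::finite \<Rightarrow> real \<Rightarrow> complex"
  assumes "\<And>i. h i \<in> trig_polys1 N"
  shows "(\<lambda>x :: real ^ 'd. \<Prod>i\<in>UNIV. h i (x $ i)) \<in> trig_polys N"
proof -
  have "\<forall>i. \<exists>c. \<forall>t. h i t = (\<Sum>k = - int N..int N. c k * expi k t)"
    using assms by (simp add: trig_polys1_def)
  from choice[OF this] obtain c where
    c: "\<And>i t. h i t = (\<Sum>k = - int N..int N. c i k * expi k t)" by auto
  let ?G = "UNIV \<rightarrow>\<^sub>E {- int N..int N} :: ('d \<Rightarrow> int) set"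
  have *: "(\<lambda>x :: real ^ 'd. \<Prod>i\<in>UNIV. h i (x $ i)) =
      (\<lambda>x. \<Sum>g\<in>?G. (\<Prod>i\<in>UNIV. c i (g i)) * (\<Prod>i\<in>UNIV. expi (g i) (x $ i)))"
    by (subst prod.distrib[symmetric], subst prod_sum_PiE[symmetric]) (simp_all add: c)
  have "(\<lambda>x :: real ^ 'd. \<Prod>i\<in>UNIV. expi (g i) (x $ i)) \<in> trig_polys N" if "g \<in> ?G" for g
  proof (rule trig_polys_expi_prod)
    show "\<bar>g i\<bar> \<le> int N" for i
      using PiE_mem[OF that, of i] by auto
  qed
  then show ?thesis
    unfolding * by (intro trig_polys_sum trig_polys_cmult) (simp_all add: finite_PiE)
qed

section \<open>The extremal univariate kernel with sine coefficients\<close>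

definition sine_coeff :: "nat \<Rightarrow> int \<Rightarrow> real" where
  "sine_coeff n k = sin (pi * of_int k / (2 * real n + 1))"

text \<open>
  The sine coefficients are the top eigenvector of the path on \<open>2 n\<close> vertices, so they maximise
  the integral of \<open>cos (2 \<pi> t) \<bar>p t\<bar>\<^sup>2\<close> relative to that of \<open>\<bar>p t\<bar>\<^sup>2\<close>.
\<close>

lemma sine_coeff_rec:
  "sine_coeff n (k + 1) + sine_coeff n (k - 1) = 2 * cos (pi / (2 * real n + 1)) * sine_coeff n k"
proof -
  let ?\<theta> = "pi / (2 * real n + 1)"
  have "sine_coeff n (k + 1) = sin (of_int k * ?\<theta> + ?\<theta>)"
    and "sine_coeff n (k - 1) = sin (of_int k * ?\<theta> - ?\<theta>)"
    and "sine_coeff n k = sin (of_int k * ?\<theta>)"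
    by (simp_all add: sine_coeff_def algebra_simps add_divide_distrib diff_divide_distrib)
  then show ?thesis by (simp add: sin_add sin_diff)
qed

text \<open>The zeros at \<open>0\<close> and at \<open>2 * n + 1\<close> let the three-term
  recurrence hold at both ends of the index range \<open>1..2 * n\<close> without correction
  terms.\<close>

lemma sine_coeff_0 [simp]: "sine_coeff n 0 = 0"
  by (simp add: sine_coeff_def)

lemma sine_coeff_end [simp]: "sine_coeff n (2 * int n + 1) = 0"
  by (simp add: sine_coeff_def)

text \<open>By orthogonality of the characters this is the integral of \<open>sine_kernel n\<close>
  over a period.\<close>

definition sine_mass :: "nat \<Rightarrow> real" where
  "sine_mass n = (\<Sum>k = 1..2 * int n. (sine_coeff n k)\<^sup>2)"

lemma sine_mass_pos:
  assumes "n \<ge> 1"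
  shows "sine_mass n > 0"
proof -
  have "pi / (2 * real n + 1) < pi" using assms by (simp add: field_simps)
  then have "sine_coeff n 1 > 0" by (auto simp: sine_coeff_def intro!: sin_gt_zero)
  then show ?thesis
    unfolding sine_mass_def using assms by (intro sum_pos2[of _ 1]) auto
qed

definition sine_kernel :: "nat \<Rightarrow> real \<Rightarrow> real" where
  "sine_kernel n t = (cmod (\<Sum>k = 1..2 * int n. of_real (sine_coeff n k) * expi k t))\<^sup>2"

lemma sine_kernel_nonneg: "sine_kernel n t \<ge> 0"
  by (simp add: sine_kernel_def)

lemma sine_kernel_expand:
  "of_real (sine_kernel n t) = (\<Sum>k = 1..2 * int n. \<Sum>l = 1..2 * int n.
     of_real (sine_coeff n k * sine_coeff n l) * expi (k - l) t)"
proof -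
  have "cnj (expi l t) = expi (- l) t" for l
    by (simp add: expi_eq_cis cis_cnj)
  then show ?thesis
    unfolding sine_kernel_def complex_norm_square
    by (simp add: sum_product mult_ac expi_add[of _ "- l" for l, simplified])
qed

text \<open>The kernel has frequencies \<open>k - l\<close> of modulus at most
  \<open>2 * n - 1\<close>; the cosine shifts them by one in each direction, so the product just
  stays within degree \<open>2 * n\<close>.\<close>

lemma cos_sine_kernel_expand:
  "of_real (cos (2 * pi * t) * sine_kernel n t) = (\<Sum>k = 1..2 * int n. \<Sum>l = 1..2 * int n.
     of_real (sine_coeff n k * sine_coeff n l / 2) * expi (k - l + 1) t +
     of_real (sine_coeff n k * sine_coeff n l / 2) * expi (k - l - 1) t)"
proof -
  have *: "expi (j - 1) t = expi j t * expi (- 1) t" for j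
    using expi_add[of j "- 1" t] by simp
  have "of_real (cos (2 * pi * t)) = (expi 1 t + expi (- 1) t) / 2"
    by (simp add: expi_eq_cis complex_eq_iff)
  then show ?thesis
    by (simp add: sine_kernel_expand sum_distrib_left expi_add * ring_distribs add_divide_distrib mult_ac)
qed

lemma sine_kernel_trig_polys1:
  "(\<lambda>t. of_real (sine_kernel n (t - s))) \<in> trig_polys1 (2 * n)"
  unfolding sine_kernel_expand by (intro trig_polys1_sum trig_polys1_expi) auto

lemma cos_sine_kernel_trig_polys1:
  "(\<lambda>t. of_real (cos (2 * pi * (t - s)) * sine_kernel n (t - s))) \<in> trig_polys1 (2 * n)"
  unfolding cos_sine_kernel_expand
  by (intro trig_polys1_sum trig_polys1_add trig_polys1_expi) auto

lemma has_bochner_integral_sine_kernel: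
  "has_bochner_integral lborel
     (\<lambda>t. indicator {0..<1} t *\<^sub>R (of_real (sine_kernel n (t - s)) :: complex))
     (of_real (sine_mass n))"
proof -
  let ?a = "\<lambda>k l. of_real (sine_coeff n k * sine_coeff n l) :: complex"
  have "has_bochner_integral lborel
     (\<lambda>t. \<Sum>k = 1..2 * int n. \<Sum>l = 1..2 * int n.
        ?a k l * (indicator {0..<1} t *\<^sub>R expi (k - l) (t - s)))
     (\<Sum>k = 1..2 * int n. \<Sum>l = 1..2 * int n. ?a k l * (if k - l = 0 then 1 else 0))"
    by (intro has_bochner_integral_sum has_bochner_integral_mult_right has_bochner_integral_expi)
  moreover have "(\<Sum>k = 1..2 * int n. \<Sum>l = 1..2 * int n. ?a k l * (if k - l = 0 then 1 else 0)) =
      of_real (sine_mass n)"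
    by (simp add: sine_mass_def power2_eq_square if_distrib[of "\<lambda>a. _ * a"] cong: if_cong)
  ultimately show ?thesis
    by (simp add: sine_kernel_expand scaleR_sum_right)
qed

text \<open>Integration keeps only the pairs of neighbouring indices, leaving half the quadratic
  form of the adjacency matrix of a path. The sine coefficients are an eigenvector, with half the
  eigenvalue equal to \<open>cos (pi / (2 * real n + 1))\<close>.\<close>

lemma has_bochner_integral_cos_sine_kernel:
  "has_bochner_integral lborel
     (\<lambda>t. indicator {0..<1} t *\<^sub>R
       (of_real (cos (2 * pi * (t - s)) * sine_kernel n (t - s)) :: complex))
     (of_real (cos (pi / (2 * real n + 1)) * sine_mass n))"
proof -
  let ?a = "\<lambda>k l. of_real (sine_coeff n k * sine_coeff n l / 2) :: complex"
  let ?b = "\<lambda>k l. (if k - l + 1 = 0 then 1 else 0) :: complex"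
  let ?c = "\<lambda>k l. (if k - l - 1 = 0 then 1 else 0) :: complex"
  have int: "has_bochner_integral lborel
     (\<lambda>t. \<Sum>k = 1..2 * int n. \<Sum>l = 1..2 * int n.
        ?a k l * (indicator {0..<1} t *\<^sub>R expi (k - l + 1) (t - s)) +
        ?a k l * (indicator {0..<1} t *\<^sub>R expi (k - l - 1) (t - s)))
     (\<Sum>k = 1..2 * int n. \<Sum>l = 1..2 * int n. ?a k l * ?b k l + ?a k l * ?c k l)"
    by (intro has_bochner_integral_sum has_bochner_integral_add has_bochner_integral_mult_right
        has_bochner_integral_expi)
  have row: "(\<Sum>l = 1..2 * int n. ?a k l * ?b k l + ?a k l * ?c k l) =
      of_real (cos (pi / (2 * real n + 1)) * (sine_coeff n k)\<^sup>2)" if "k \<in> {1..2 * int n}" for k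
  proof -
    have "(\<Sum>l = 1..2 * int n. ?a k l * ?b k l) = (\<Sum>l = 1..2 * int n. if l = k + 1 then ?a k l else 0)"
      by (intro sum.cong) auto
    \<comment> \<open>For \<open>k = 2 * n\<close> the index \<open>k + 1\<close> leaves the range
      of summation, but its coefficient is zero.\<close>
    also have "\<dots> = ?a k (k + 1)"
      using that by (cases "k = 2 * int n") auto
    finally have 1: "(\<Sum>l = 1..2 * int n. ?a k l * ?b k l) = ?a k (k + 1)" .
    have "(\<Sum>l = 1..2 * int n. ?a k l * ?c k l) = (\<Sum>l = 1..2 * int n. if l = k - 1 then ?a k l else 0)"
      by (intro sum.cong) auto
    \<comment> \<open>Likewise at the lower end: for \<open>k = 1\<close> the missing neighbour has
      coefficient \<open>sine_coeff n 0 = 0\<close>.\<close>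
    also have "\<dots> = ?a k (k - 1)"
      using that by (cases "k = 1") auto
    finally have 2: "(\<Sum>l = 1..2 * int n. ?a k l * ?c k l) = ?a k (k - 1)" .
    have "?a k (k + 1) + ?a k (k - 1) =
        of_real (sine_coeff n k / 2 * (sine_coeff n (k + 1) + sine_coeff n (k - 1)))"
      by (simp add: field_simps)
    then show ?thesis
      unfolding sum.distrib 1 2 sine_coeff_rec by (simp add: power2_eq_square)
  qed
  have "(\<Sum>k = 1..2 * int n. \<Sum>l = 1..2 * int n. ?a k l * ?b k l + ?a k l * ?c k l) =
      of_real (cos (pi / (2 * real n + 1)) * sine_mass n)"
    by (simp only: row sine_mass_def sum_distrib_left of_real_sum cong: sum.cong)
  with int show ?thesis
    unfolding cos_sine_kernel_expand by (simp add: scaleR_sum_right scaleR_add_right)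
qed

section \<open>The quadrature rule on the test function\<close>

text \<open>Each summand of the cosine sum touches a single coordinate, so the test function is a
  linear combination of products of univariate functions. Both its degree and its integral can then
  be read off coordinatewise. The constant \<open>A\<close> is left free, since two different values
  are used later.\<close>

lemma exact_quadrature_sine_kernel:
  fixes x :: "nat \<Rightarrow> real ^ 'd" and y :: "real ^ 'd"
  assumes "exact_quadrature m x w (2 * n)"
  shows "(\<Sum>j = 1..m. w j * (((\<Sum>i\<in>UNIV. cos (2 * pi * (x j $ i - y $ i))) - A) *
            (\<Prod>i\<in>UNIV. sine_kernel n (x j $ i - y $ i)))) =
         (real CARD('d) * cos (pi / (2 * real n + 1)) - A) * sine_mass n ^ CARD('d)"
proof -
  define u :: "'d \<Rightarrow> real \<Rightarrow> complex" where
    "u i t = of_real (sine_kernel n (t - y $ i))" for i t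
  define v :: "'d \<Rightarrow> real \<Rightarrow> complex" where
    "v i t = of_real (cos (2 * pi * (t - y $ i)) * sine_kernel n (t - y $ i))" for i t
  \<comment> \<open>The product over \<open>j\<close> of \<open>h i j\<close> is the summand in
    which the cosine sits on coordinate \<open>i\<close>.\<close>
  define h where "h i j = (if j = i then v j else u j)" for i j
  define f where "f p = (\<Sum>i\<in>UNIV. \<Prod>j\<in>UNIV. h i j (p $ j)) + (- of_real A) * (\<Prod>j\<in>UNIV. u j (p $ j))"
    for p :: "real ^ 'd"
  let ?c = "cos (pi / (2 * real n + 1))"

  have u: "has_bochner_integral lborel (\<lambda>t. indicator {0..<1} t *\<^sub>R u i t) (of_real (sine_mass n))" for i
    unfolding u_def by (rule has_bochner_integral_sine_kernel)
  have v: "has_bochner_integral lborel (\<lambda>t. indicator {0..<1} t *\<^sub>R v i t) (of_real (?c * sine_mass n))" for i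
    unfolding v_def by (rule has_bochner_integral_cos_sine_kernel)
  have h: "has_bochner_integral lborel (\<lambda>t. indicator {0..<1} t *\<^sub>R h i j t)
      (of_real ((if j = i then ?c else 1) * sine_mass n))" for i j
    using u[of j] v[of j] by (cases "j = i") (simp_all add: h_def)
  have single: "(\<Prod>j\<in>UNIV. (if j = i then a j else 1) * b j) = a i * (\<Prod>j\<in>UNIV. b j)"
    for a b :: "'d \<Rightarrow> real" and i
    by (simp add: prod.distrib)
  have int_u: "has_bochner_integral lborel (\<lambda>p. indicator torus p *\<^sub>R (\<Prod>j\<in>UNIV. u j (p $ j)))
      (of_real (sine_mass n ^ CARD('d)))"
    using has_bochner_integral_torus_prod[of u] u
    by (simp add: has_bochner_integral_iff set_integrable_def set_lebesgue_integral_def)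
  have int_h: "has_bochner_integral lborel (\<lambda>p. indicator torus p *\<^sub>R (\<Prod>j\<in>UNIV. h i j (p $ j)))
      (of_real (?c * sine_mass n ^ CARD('d)))" for i
  proof -
    have "(\<Prod>j\<in>UNIV. LINT t:{0..<1}|lborel. h i j t) =
        of_real (\<Prod>j\<in>UNIV. (if j = i then ?c else 1) * sine_mass n)"
      using h by (simp add: has_bochner_integral_iff set_lebesgue_integral_def)
    also have "\<dots> = of_real (?c * sine_mass n ^ CARD('d))"
      by (subst single) simp
    finally show ?thesis
      using has_bochner_integral_torus_prod[of "h i"] h
      by (simp add: has_bochner_integral_iff set_integrable_def)
  qed
  have "has_bochner_integral lborel (\<lambda>p. (\<Sum>i\<in>UNIV. indicator torus p *\<^sub>R (\<Prod>j\<in>UNIV. h i j (p $ j))) +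
      (- of_real A) * (indicator torus p *\<^sub>R (\<Prod>j\<in>UNIV. u j (p $ j))))
      ((\<Sum>i\<in>(UNIV :: 'd set). of_real (?c * sine_mass n ^ CARD('d))) +
       (- of_real A) * of_real (sine_mass n ^ CARD('d)))"
    by (intro has_bochner_integral_add has_bochner_integral_sum has_bochner_integral_mult_right
        int_h int_u)
  then have integral: "(LINT p:torus|lborel. f p) = of_real ((real CARD('d) * ?c - A) * sine_mass n ^ CARD('d))"
    unfolding f_def set_lebesgue_integral_def has_bochner_integral_iff
    by (simp add: scaleR_add_right scaleR_diff_right scaleR_sum_right algebra_simps)
  have member: "f \<in> trig_polys (2 * n)"
  proof -
    have u1: "u i \<in> trig_polys1 (2 * n)" and v1: "v i \<in> trig_polys1 (2 * n)" for i
      unfolding u_def v_def by (rule sine_kernel_trig_polys1 cos_sine_kernel_trig_polys1)+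
    then have "h i j \<in> trig_polys1 (2 * n)" for i j by (simp add: h_def)
    with u1 show ?thesis
      unfolding f_def
      by (intro trig_polys_add trig_polys_sum trig_polys_cmult trig_polys_prod) auto
  qed
  have f_eq: "f p = of_real (((\<Sum>i\<in>UNIV. cos (2 * pi * (p $ i - y $ i))) - A) *
            (\<Prod>i\<in>UNIV. sine_kernel n (p $ i - y $ i)))" for p
  proof -
    have "(\<Prod>j\<in>UNIV. h i j (p $ j)) = of_real (\<Prod>j\<in>UNIV.
        (if j = i then cos (2 * pi * (p $ j - y $ j)) else 1) * sine_kernel n (p $ j - y $ j))" for i
      unfolding of_real_prod by (intro prod.cong) (auto simp: h_def u_def v_def)
    then show ?thesis
      by (simp only: single f_def u_def) (simp add: algebra_simps sum_distrib_left)
  qed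
  have "(\<Sum>j = 1..m. of_real (w j) * f (x j)) = (LINT p:torus|lborel. f p)"
    using assms member unfolding exact_quadrature_def by blast
  then show ?thesis
    unfolding integral unfolding f_eq by (simp only: of_real_eq_iff flip: of_real_mult of_real_sum)
qed

section \<open>Trigonometric inequalities and the wrap-around distance\<close>

text \<open>Jordan's inequality: by concavity the sine lies above its chord from \<open>0\<close> to
  \<open>pi / 2\<close>.\<close>

lemma sin_ge_chord:
  fixes x :: real
  assumes "0 \<le> x" "x \<le> pi / 2"
  shows "2 * x / pi \<le> sin x"
proof -
  have "concave_on {0..pi} sin"
    by (rule f''_le0_imp_concave[where f' = cos and f'' = "\<lambda>x. - sin x"])
      (auto intro!: derivative_eq_intros sin_ge_zero)
  from concave_onD[OF this, of "2 * x / pi" 0 "pi / 2"] show ?thesis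
    using assms by (simp add: field_simps)
qed

text \<open>Rounding each coordinate difference to the nearest integer gives a lattice shift whose
  residues have modulus at most \<open>1 / 2\<close>. Some residue exceeds \<open>r\<close> in
  modulus, and the cosine is even, periodic and strictly decreasing on
  \<open>[0, pi]\<close>.\<close>

lemma wrap_dist_gt_cos:
  fixes x y :: "real ^ 'd"
  assumes "0 \<le> r" "r < wrap_dist x y"
  shows "r < 1 / 2" and "\<exists>i. cos (2 * pi * (x $ i - y $ i)) < cos (2 * pi * r)"
proof -
  define z :: "real ^ 'd" where "z = (\<chi> i. - of_int (round (x $ i - y $ i)))"
  have "wrap_dist x y \<le> infnorm (x - y + z)"
    unfolding wrap_dist_def by (rule cINF_lower[OF wrap_dist_bdd]) (simp add: z_def int_lattice_def)
  with assms have "r < infnorm (x - y + z)" by simp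
  moreover have "infnorm (x - y + z) \<le> r" if "\<And>i. \<bar>(x - y + z) $ i\<bar> \<le> r"
    unfolding infnorm_cart using that by (intro cSup_least) auto
  ultimately obtain i where i: "r < \<bar>(x - y + z) $ i\<bar>"
    by (meson not_le)
  define s where "s = x $ i - y $ i - of_int (round (x $ i - y $ i))"
  have s: "r < \<bar>s\<bar>" "\<bar>s\<bar> \<le> 1 / 2"
    using i of_int_round_abs_le[of "x $ i - y $ i"] by (simp_all add: s_def z_def abs_minus_commute)
  then show "r < 1 / 2" by simp
  have "cos (2 * pi * \<bar>s\<bar>) < cos (2 * pi * r)"
    using s assms(1) by (intro cos_monotone_0_pi) (auto simp: field_simps)
  moreover have "cos (2 * pi * \<bar>s\<bar>) = cos (2 * pi * s)" by (simp add: abs_if)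
  moreover have "cos (2 * pi * s) = cos (2 * pi * (x $ i - y $ i))"
    by (simp add: s_def right_diff_distrib cos_diff)
  ultimately show "\<exists>i. cos (2 * pi * (x $ i - y $ i)) < cos (2 * pi * r)" by auto
qed

text \<open>Writing \<open>1 - cos\<close> as twice the squared sine of the half angle, Jordan's
  inequality bounds one side and \<open>\<bar>sin x\<bar> \<le> \<bar>x\<bar>\<close> the other.
  What remains is \<open>d * pi\<^sup>2 < 16 * 4 ^ (d - 1)\<close>.\<close>

lemma cos_gap:
  fixes d :: nat and M :: real
  assumes "d \<ge> 1" "M > 0" "2 ^ (d - 1) / M < 1 / 2"
  shows "real d - 1 + cos (2 * pi * (2 ^ (d - 1) / M)) < real d * cos (pi / M)"
proof -
  define r where "r = 2 ^ (d - 1) / M"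
  have r: "0 \<le> r" "r < 1 / 2" using assms by (simp_all add: r_def)
  have "2 * r \<le> sin (pi * r)"
    using sin_ge_chord[of "pi * r"] r by (simp add: field_simps)
  then have "(2 * r)\<^sup>2 \<le> (sin (pi * r))\<^sup>2"
    using r by (intro power_mono) auto
  moreover have "cos (2 * pi * r) = 1 - 2 * (sin (pi * r))\<^sup>2"
    using cos_double_sin[of "pi * r"] by (simp add: mult_ac)
  ultimately have upper: "cos (2 * pi * r) \<le> 1 - 8 * r\<^sup>2"
    by (simp add: power_mult_distrib)
  have "(sin (pi / (2 * M)))\<^sup>2 \<le> (pi / (2 * M))\<^sup>2"
    using abs_sin_x_le_abs_x[of "pi / (2 * M)"] by (simp only: abs_le_square_iff)
  moreover have "cos (pi / M) = 1 - 2 * (sin (pi / (2 * M)))\<^sup>2"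
    using cos_double_sin[of "pi / (2 * M)"] by simp
  ultimately have "1 - 2 * (pi / (2 * M))\<^sup>2 \<le> cos (pi / M)"
    by simp
  then have lower: "real d * (1 - pi\<^sup>2 / (2 * M\<^sup>2)) \<le> real d * cos (pi / M)"
    by (intro mult_left_mono) (simp_all add: power_divide power_mult_distrib)
  \<comment> \<open>The crude bounds \<open>pi < 4\<close> and \<open>d \<le> 4 ^ (d - 1)\<close>
    suffice; the first supplies the strictness.\<close>
  have "pi\<^sup>2 < 4\<^sup>2" using pi_less_4 by (intro power_strict_mono) auto
  then have "real d * pi\<^sup>2 < real d * 16" using assms(1) by simp
  also have "real d * 16 \<le> 16 * 4 ^ (d - 1)"
  proof -
    have "k + 1 \<le> 4 ^ k" for k :: nat by (induction k) auto
    from this[of "d - 1"] have "d \<le> 4 ^ (d - 1)" using assms(1) by simp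
    then have "real d \<le> 4 ^ (d - 1)" by (metis of_nat_le_iff of_nat_numeral of_nat_power)
    then show ?thesis by simp
  qed
  also have "\<dots> = 16 * r\<^sup>2 * M\<^sup>2"
    using assms(2) by (simp add: r_def power_divide flip: power_mult power2_eq_square)
      (simp add: mult.commute[of _ 2] power_mult)
  finally have "real d * (pi\<^sup>2 / (2 * M\<^sup>2)) < 8 * r\<^sup>2"
    using assms(2) by (simp add: field_simps)
  with upper lower show ?thesis
    unfolding r_def[symmetric] by (simp add: right_diff_distrib)
qed

section \<open>Contradiction from a point far from all nodes\<close>

theorem theorem3p3:
  fixes n m :: nat and x :: "nat \<Rightarrow> real ^ 'd" and w :: "nat \<Rightarrow> real"
  assumes "n \<ge> 1"
    and "\<And>j. j \<in> {1..m} \<Longrightarrow> x j \<in> torus"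
    and "\<And>j. j \<in> {1..m} \<Longrightarrow> w j > 0"
    and "exact_quadrature m x w (2 * n)"
  shows "covering_radius m x \<le> 2 ^ (CARD('d) - 1) / (2 * real n + 1)"
proof (rule ccontr)
  let ?d = "CARD('d)" and ?c = "cos (pi / (2 * real n + 1))"
  define r :: real where "r = 2 ^ (?d - 1) / (2 * real n + 1)"
  assume "\<not> covering_radius m x \<le> 2 ^ (?d - 1) / (2 * real n + 1)"
  then have large: "r < covering_radius m x" by (simp add: r_def)
  have r: "0 \<le> r" by (simp add: r_def)
  have S: "sine_mass n ^ ?d > 0" using sine_mass_pos[OF assms(1)] by simp
  \<comment> \<open>An empty rule would give zero, while the choice \<open>A = d * ?c - 1\<close>
    makes the integral equal to \<open>sine_mass n ^ d\<close>, which is positive. A node is needed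
    for the maximum in \<open>covering_radius\<close> to be attained.\<close>
  have m: "m \<ge> 1"
  proof (rule ccontr)
    assume "\<not> m \<ge> 1"
    then show False
      using exact_quadrature_sine_kernel[OF assms(4), of 0 "real ?d * ?c - 1"]
        sine_mass_pos[OF assms(1)] by simp
  qed
  obtain y where y: "min_dist m x y = covering_radius m x"
    using covering_radius_is_max(1)[OF m, of x] by force
  have far: "r < wrap_dist (x j) y" if "j \<in> {1..m}" for j
  proof -
    have "min_dist m x y \<le> wrap_dist (x j) y"
      unfolding min_dist_def using that by (intro Min_le) auto
    with large y show ?thesis by simp
  qed
  \<comment> \<open>This bounds the cosine sum when one cosine is at most
    \<open>cos (2 * pi * r)\<close> and the other \<open>d - 1\<close> are at most 1, as happens at
    every node.\<close>
  define A where "A = real ?d - 1 + cos (2 * pi * r)"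
  have "(\<Sum>i\<in>UNIV. cos (2 * pi * (x j $ i - y $ i))) - A \<le> 0" if j: "j \<in> {1..m}" for j
  proof -
    obtain i where i: "cos (2 * pi * (x j $ i - y $ i)) < cos (2 * pi * r)"
      using wrap_dist_gt_cos(2)[OF r far[OF j]] by blast
    have "(\<Sum>i\<in>UNIV. cos (2 * pi * (x j $ i - y $ i))) =
        cos (2 * pi * (x j $ i - y $ i)) + (\<Sum>k\<in>UNIV - {i}. cos (2 * pi * (x j $ k - y $ k)))"
      by (intro sum.remove) auto
    also have "(\<Sum>k\<in>UNIV - {i}. cos (2 * pi * (x j $ k - y $ k))) \<le> (\<Sum>k\<in>UNIV - {i}. 1)"
      by (intro sum_mono) simp
    also have "\<dots> = real ?d - 1"
      by (simp add: card_Diff_singleton of_nat_diff Suc_leI)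
    finally show ?thesis using i by (simp add: A_def)
  qed
  then have "(\<Sum>j = 1..m. w j * (((\<Sum>i\<in>UNIV. cos (2 * pi * (x j $ i - y $ i))) - A) *
      (\<Prod>i\<in>UNIV. sine_kernel n (x j $ i - y $ i)))) \<le> 0"
    by (intro sum_nonpos mult_nonneg_nonpos mult_nonpos_nonneg prod_nonneg)
      (auto simp: sine_kernel_nonneg less_imp_le[OF assms(3)])
  then have "(real ?d * ?c - A) * sine_mass n ^ ?d \<le> 0"
    by (simp only: exact_quadrature_sine_kernel[OF assms(4)])
  moreover have "A < real ?d * ?c"
    unfolding A_def r_def
  proof (rule cos_gap)
    \<comment> \<open>Any node at distance more than \<open>r\<close> forces
      \<open>r < 1 / 2\<close>; node 1 exists because \<open>m \<ge> 1\<close>.\<close>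
    show "2 ^ (?d - 1) / (2 * real n + 1) < (1 / 2 :: real)"
      using wrap_dist_gt_cos(1)[OF r far[of 1]] m by (simp add: r_def)
  qed (simp_all add: Suc_leI)
  ultimately show False using S by (simp add: mult_le_0_iff)
qed

end
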